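(* Let $n,m\ge1$ and let $T_m$ be a knot vector as in the context. The functions $L_{n+k,n}$ $(k=1,2,\ldots,m)$ defined in the context can be written on $[0,1]$ in terms of the B-spline functions of degree $n$ over $T_m$ as $$L_{n+k,n}(t)=\sum_{i=0}^{n+m}\gamma_{i,k}N_{-n+i,n}^m(t)\quad(k=1,2,\ldots,m-1),\qquad L_{n+m,n}(t)=\sum_{i=0}^{n+m}\beta_{i,m}N_{-n+i,n}^m(t),$$ where, for any $s_i\in\big[t^{(m)}_{-n+i},\,t^{(m)}_{i+1}\big)$, $$\gamma_{i,k}:=\sum_{h=0}^{n+k}\beta_{h,k}\big(t^{(k)}_{h+1}-t^{(k)}_{-n+h}\big)\big[t^{(k)}_{-n+h},t^{(k)}_{-n+h+1},\ldots,t^{(k)}_{h+1}\big]g_i,$$ $$g_i(y):=(y-s_i)_+^0\prod_{r=1}^{n}\big(y-t^{(m)}_{-n+i+r}\big),\qquad \beta_{h,k}:=\frac{(2n+1)!}{n!}\sum_{j=0}^{k-1}\alpha_{-n+j,k}\lambda_{n+1,h-j}^{(j,k)},$$ with $\lambda_{0,0}^{(j,k)}:=1$ and $$\lambda_{v,q}^{(j,k)}:=\frac{\lambda_{v-1,q}^{(j,k)}-\lambda_{v-1,q-1}^{(j,k)}}{t^{(k)}_{n+j+q-v+2}-t^{(k)}_{-n+j+q}}\qquad(v=1,2,\ldots,n+1;\ q=0,1,\ldots,v).$$ Here $\lambda_{u,w}^{(j,k)}=0$ if $w<0$ or $w>u$, and if a denominator is $0$ then the corresponding quotient is defined to be $0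$.
   Context: Knots. Let $0<t_1\le t_2\le\cdots\le t_m<1$ be such that no value occurs more than $n$ times among $t_1,\ldots,t_m$. For $0\le k\le m$ the knot vector $T_k=(t^{(k)}_{-n},t^{(k)}_{-n+1},\ldots,t^{(k)}_{n+k+1})$ is given by $t^{(k)}_{-n}=\cdots=t^{(k)}_0=0$, $t^{(k)}_i=t_i$ for $1\le i\le k$, and $t^{(k)}_{k+1}=\cdots=t^{(k)}_{n+k+1}=1$. B-splines. The B-splines over $T_k$ are defined by $N_{i,0}^k(t)=1$ if $t^{(k)}_i\le t<t^{(k)}_{i+1}$ and $0$ otherwise, and for degree $d\ge1$ $$N_{i,d}^k(t)=\frac{t-t_i^{(k)}}{t_{i+d}^{(k)}-t_i^{(k)}}N_{i,d-1}^k(t)+\frac{t_{i+d+1}^{(k)}-t}{t_{i+d+1}^{(k)}-t_{i+1}^{(k)}}N_{i+1,d-1}^k(t),$$ for all $i$ with $-n\le i$ and $i+d+1\le n+k+1$, a quotient with zero denominator being $0$. Values (and derivatives) at $t=1$ are understood as limits from the left, and derivatives at $t=0$ from the right. $\Omega_n[T_k]$ is the space of spline functions on $[0,1]$ of degree at most $n$ over $T_k$, with basis $N_{-n,n}^k,\ldots,N_{k,n}^k$. Legendre-like orthogonal basis. For $i=0,\ldots,n$: $L_{i,n}(t)=\frac{1}{i!}\frac{d^i}{dt^i}\big[(1-t)^it^i\big]$. For $k=1,\ldots,m$: $$L_{n+k,n}(t)=\frac{d^{n+1}}{dt^{n+1}}f_k(t),\qquad f_k(t)=\sum_{j=0}^{k-1}\alpha_{-n+j,k}N_{-n+j,2n+1}^k(t),$$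 where the real coefficients $\alpha_{-n+j,k}$ (unique for each $k$ up to a common nonzero factor) are such that $L_{0,n},L_{1,n},\ldots,L_{n+m,n}$ is an orthogonal basis of $\Omega_n[T_m]$ with respect to $\langle f,g\rangle_L=\int_0^1f(t)g(t)\,dt$ (a known result of Wei, Guo and Yang). Other notation. $(y-s)_+^0=1$ for $y>s$ and $0$ for $y\le s$. $[x_1,\ldots,x_l]g$ denotes the divided difference of $g$ (confluent, i.e. using derivatives, at repeated nodes; derivatives of $g_i$ at $y=s_i$ are taken from the left, consistently with $(0)_+^0=0$). *)

theory Defs
  imports "HOL-Analysis.Analysis" "HOL-Computational_Algebra.Polynomial"
begin

section \<open>Knots and B-splines\<close>

definition knots_ok :: "nat \<Rightarrow> nat \<Rightarrow> (nat \<Rightarrow> real) \<Rightarrow> bool" where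
  "knots_ok n m t \<longleftrightarrow>
     (\<forall>i\<in>{1..m}. 0 < t i \<and> t i < 1) \<and>
     (\<forall>i\<in>{1..m}. \<forall>j\<in>{1..m}. i \<le> j \<longrightarrow> t i \<le> t j) \<and>
     (\<forall>x. card {i\<in>{1..m}. t i = x} \<le> n)"

text \<open>The knot vector \<open>T\<^sub>k\<close> as a function on the integers. Only the indices
  \<open>-n, \<dots>, n + k + 1\<close> belong to the knot vector (and only these are used below);
  the constant continuation beyond them makes the definition independent of \<open>n\<close>.\<close>

definition knot :: "(nat \<Rightarrow> real) \<Rightarrow> nat \<Rightarrow> int \<Rightarrow> real" where
  "knot t k i = (if i \<le> 0 then 0 else if i \<le> int k then t (nat i) else 1)"

text \<open>The Cox--de Boor recursion; \<open>x / 0 = 0\<close> is the required convention for quotients.\<close>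

fun bspline_rec :: "(int \<Rightarrow> real) \<Rightarrow> int \<Rightarrow> nat \<Rightarrow> real \<Rightarrow> real" where
  "bspline_rec T i 0 x = (if T i \<le> x \<and> x < T (i + 1) then 1 else 0)"
| "bspline_rec T i (Suc d) x =
     (x - T i) / (T (i + int (Suc d)) - T i) * bspline_rec T i d x
     + (T (i + int (Suc d) + 1) - x) / (T (i + int (Suc d) + 1) - T (i + 1))
       * bspline_rec T (i + 1) d x"

text \<open>The recursion gives the value 0 at the right end point 1; the value there is understood
  as the limit from the left.\<close>

definition bspline :: "(int \<Rightarrow> real) \<Rightarrow> int \<Rightarrow> nat \<Rightarrow> real \<Rightarrow> real" where
  "bspline T i d x =
     (if x = 1 then Lim (at_left 1) (bspline_rec T i d) else bspline_rec T i d x)"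

text \<open>The spline functions on \<open>[0,1]\<close> of degree at most \<open>n\<close> over \<open>T\<^sub>k\<close>: piecewise polynomials that
  are \<open>n - \<mu>\<close> times continuously differentiable at each interior point that occurs \<open>\<mu> \<le> n\<close> times
  among the knots. Elements are functions on all of the reals, but only their values on \<open>[0,1]\<close>
  matter.\<close>

definition spline_space :: "nat \<Rightarrow> (nat \<Rightarrow> real) \<Rightarrow> nat \<Rightarrow> (real \<Rightarrow> real) set" where
  "spline_space n t k = {f.
     (\<forall>i\<in>{0..int k}. \<exists>p. degree p \<le> n \<and>
        (\<forall>x. knot t k i \<le> x \<and> x < knot t k (i + 1) \<longrightarrow> f x = poly p x)) \<and>
     (f \<longlongrightarrow> f 1) (at_left 1) \<and>
     (\<forall>x. 0 < x \<and> x < 1 \<longrightarrow>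
        (let r = n - card {i\<in>{1..k}. t i = x} in
           (\<forall>l<r. (deriv ^^ l) f differentiable (at x)) \<and> isCont ((deriv ^^ r) f) x))}"

section \<open>The Legendre-like orthogonal basis\<close>

text \<open>Derivative on \<open>[0,1]\<close>: from the right at 0, from the left at 1, two-sided in between.\<close>

definition deriv01 :: "(real \<Rightarrow> real) \<Rightarrow> real \<Rightarrow> real" where
  "deriv01 f = (\<lambda>x. vector_derivative f (at x within {0..1}))"

definition fk :: "nat \<Rightarrow> (nat \<Rightarrow> real) \<Rightarrow> (int \<Rightarrow> nat \<Rightarrow> real) \<Rightarrow> nat \<Rightarrow> real \<Rightarrow> real" where
  "fk n t \<alpha> k x =
     (\<Sum>j=0..<k. \<alpha> (- int n + int j) k * bspline (knot t k) (- int n + int j) (2 * n + 1) x)"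

text \<open>\<open>LL n t \<alpha> l\<close> is \<open>L\<^bsub>l,n\<^esub>\<close>.\<close>

definition LL :: "nat \<Rightarrow> (nat \<Rightarrow> real) \<Rightarrow> (int \<Rightarrow> nat \<Rightarrow> real) \<Rightarrow> nat \<Rightarrow> real \<Rightarrow> real" where
  "LL n t \<alpha> l x =
     (if l \<le> n then 1 / fact l * (deriv01 ^^ l) (\<lambda>y. (1 - y) ^ l * y ^ l) x
      else (deriv01 ^^ (n + 1)) (fk n t \<alpha> (l - n)) x)"

definition inner_L :: "(real \<Rightarrow> real) \<Rightarrow> (real \<Rightarrow> real) \<Rightarrow> real" where
  "inner_L f g = integral {0..1} (\<lambda>x. f x * g x)"

text \<open>\<open>L 0, \<dots>, L M\<close> is an orthogonal basis of \<open>V\<close>, functions being identified when they agree on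
  \<open>[0,1]\<close>.\<close>

definition orthogonal_basis :: "(real \<Rightarrow> real) set \<Rightarrow> nat \<Rightarrow> (nat \<Rightarrow> real \<Rightarrow> real) \<Rightarrow> bool" where
  "orthogonal_basis V M L \<longleftrightarrow>
     (\<forall>l\<le>M. L l \<in> V) \<and>
     (\<forall>l\<le>M. \<forall>l'\<le>M. l \<noteq> l' \<longrightarrow> inner_L (L l) (L l') = 0) \<and>
     (\<forall>c. (\<forall>x\<in>{0..1}. (\<Sum>l\<le>M. c l * L l x) = 0) \<longrightarrow> (\<forall>l\<le>M. c l = 0)) \<and>
     (\<forall>f\<in>V. \<exists>c. \<forall>x\<in>{0..1}. f x = (\<Sum>l\<le>M. c l * L l x))"

section \<open>The B-spline coefficients\<close>

definition left_deriv :: "(real \<Rightarrow> real) \<Rightarrow> real \<Rightarrow> real" where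
  "left_deriv g = (\<lambda>x. vector_derivative g (at_left x))"

text \<open>\<open>divdiff g T a l\<close> is the confluent divided difference \<open>[T a, T (a + 1), \<dots>, T (a + l)] g\<close> for a
  nondecreasing \<open>T\<close> (so that all nodes coincide if the outer ones do). Derivatives at repeated nodes
  are taken from the left, which only matters where \<open>g\<close> is not smooth.\<close>

fun divdiff :: "(real \<Rightarrow> real) \<Rightarrow> (int \<Rightarrow> real) \<Rightarrow> int \<Rightarrow> nat \<Rightarrow> real" where
  "divdiff g T a 0 = g (T a)"
| "divdiff g T a (Suc l) =
     (if T a = T (a + int (Suc l)) then (left_deriv ^^ Suc l) g (T a) / fact (Suc l)
      else (divdiff g T (a + 1) l - divdiff g T a l) / (T (a + int (Suc l)) - T a))"

fun lam :: "nat \<Rightarrow> (int \<Rightarrow> real) \<Rightarrow> nat \<Rightarrow> nat \<Rightarrow> int \<Rightarrow> real" where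
  "lam n T j 0 q = (if q = 0 then 1 else 0)"
| "lam n T j (Suc v) q =
     (if 0 \<le> q \<and> q \<le> int (Suc v)
      then (lam n T j v q - lam n T j v (q - 1))
           / (T (int n + int j + q - int (Suc v) + 2) - T (- int n + int j + q))
      else 0)"

definition beta :: "nat \<Rightarrow> (nat \<Rightarrow> real) \<Rightarrow> (int \<Rightarrow> nat \<Rightarrow> real) \<Rightarrow> nat \<Rightarrow> nat \<Rightarrow> real" where
  "beta n t \<alpha> h k =
     fact (2 * n + 1) / fact n *
     (\<Sum>j=0..<k. \<alpha> (- int n + int j) k * lam n (knot t k) j (n + 1) (int h - int j))"

definition gfun :: "nat \<Rightarrow> nat \<Rightarrow> (nat \<Rightarrow> real) \<Rightarrow> (nat \<Rightarrow> real) \<Rightarrow> nat \<Rightarrow> real \<Rightarrow> real" where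
  "gfun n m t s i y =
     (if y > s i then 1 else 0) * (\<Prod>r=1..n. y - knot t m (- int n + int i + int r))"

definition gam :: "nat \<Rightarrow> nat \<Rightarrow> (nat \<Rightarrow> real) \<Rightarrow> (int \<Rightarrow> nat \<Rightarrow> real) \<Rightarrow> (nat \<Rightarrow> real) \<Rightarrow> nat \<Rightarrow> nat \<Rightarrow> real"
  where
  "gam n m t \<alpha> s i k =
     (\<Sum>h=0..n + k. beta n t \<alpha> h k *
        (knot t k (int h + 1) - knot t k (- int n + int h)) *
        divdiff (gfun n m t s i) (knot t k) (- int n + int h) (n + 1))"

end

theory Submission
  imports Defs
begin

text \<open>
  Both expansions rest on one formula: with \<open>(y - x)\<^sub>+\<^sup>d\<close> regarded as a function of \<open>y\<close>,
  the B-spline of degree \<open>d\<close> is \<open>T (i + d + 1) - T i\<close> times its divided difference over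
  \<open>T i, \<dots>, T (i + d + 1)\<close> (\<open>bspline_rec_eq_hermite_dd\<close>). The Leibniz rule for a linear factor turns
  divided differences of \<open>(y - x) (y - x)\<^sub>+\<^sup>d\<close> into those of \<open>(y - x)\<^sub>+\<^sup>d\<close>, and this is the Cox--de Boor
  recursion.

  The coefficients \<open>\<beta>\<close> come from differentiating in \<open>x\<close> under the divided difference. Since
  \<open>(y - x)\<^sub>+\<^sup>d\<close> has derivative \<open>- d (y - x)\<^sub>+\<^bsup>d - 1\<^esup>\<close>, the derivative of a B-spline is \<open>d\<close> times a
  difference of two normalised B-splines of degree \<open>d - 1\<close> (\<open>bspline_has_derivative\<close>). Summation by
  parts turns each differentiation into one step of the recursion for \<open>\<lambda>\<close>, and \<open>n + 1\<close> steps lead from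
  degree \<open>2n + 1\<close> to degree \<open>n\<close> (\<open>LL_eq_beta_sum\<close>). An interior knot has multiplicity at most \<open>n\<close>, so
  all these derivatives exist in the classical sense.

  The coefficients \<open>\<gamma>\<close> arise when the B-splines over \<open>T\<^sub>k\<close> are expanded over the finer knots \<open>T\<^sub>m\<close>.
  Marsden's identity writes \<open>(y - x)\<^sup>n\<close> as the sum of \<open>N\<^sub>i(x) \<psi>\<^sub>i(y)\<close>, where \<open>\<psi>\<^sub>i\<close> vanishes at the \<open>n\<close>
  inner knots of \<open>N\<^sub>i\<close>. In the truncated version the cut may be moved, for each \<open>i\<close> separately, from \<open>x\<close>
  to any \<open>s\<^sub>i\<close> in the support of \<open>N\<^sub>i\<close>: this only changes values at knots between \<open>x\<close> and \<open>s\<^sub>i\<close>, where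
  \<open>\<psi>\<^sub>i\<close> vanishes to the order of the multiplicity. Hence \<open>(y - x)\<^sub>+\<^sup>n\<close> and the sum of \<open>N\<^sub>i(x) g\<^sub>i(y)\<close>
  have the same Hermite data at the knots, so the same divided differences over \<open>T\<^sub>k\<close>
  (\<open>bspline_rec_knot_insertion\<close>, \<open>bspline_knot_insertion\<close>).
\<close>

section \<open>Divided differences of Hermite data\<close>

text \<open>A confluent divided difference sees its function only through values and derivatives at the
  nodes. Here \<open>G l y\<close> stands for the \<open>l\<close>-th derivative at \<open>y\<close>, without any function behind it. The
  divided difference then is linear in its data, and limits and derivatives with respect to a parameter
  can be taken at each node separately, also where the underlying functions are not smooth.\<close>

fun hermite_dd :: "(nat \<Rightarrow> real \<Rightarrow> real) \<Rightarrow> (int \<Rightarrow> real) \<Rightarrow> int \<Rightarrow> nat \<Rightarrow> real" where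
  "hermite_dd G T a 0 = G 0 (T a)"
| "hermite_dd G T a (Suc l) =
     (if T a = T (a + int (Suc l)) then G (Suc l) (T a) / fact (Suc l)
      else (hermite_dd G T (a + 1) l - hermite_dd G T a l) / (T (a + int (Suc l)) - T a))"

lemma hermite_dd_sum:
  "hermite_dd (\<lambda>l y. \<Sum>i\<in>I. c i * G i l y) T a L = (\<Sum>i\<in>I. c i * hermite_dd (G i) T a L)"
proof (induction L arbitrary: a)
  case (Suc L)
  show ?case
    by (simp add: Suc.IH sum_divide_distrib flip: sum_subtractf)
       (simp add: algebra_simps diff_divide_distrib)
qed simp

text \<open>A derivative of order \<open>l\<close> at a node matters only if that node is repeated at least \<open>l + 1\<close>
  times. This is what makes multiplicity bounds on knots effective below.\<close>

lemma hermite_dd_cong: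
  assumes "\<And>b l. a \<le> b \<Longrightarrow> b + int l \<le> a + int L \<Longrightarrow> T b = T (b + int l) \<Longrightarrow>
             G l (T b) = H l (T b)"
  shows "hermite_dd G T a L = hermite_dd H T a L"
  using assms
proof (induction L arbitrary: a)
  case 0
  show ?case using 0[of a 0] by simp
next
  case (Suc L)
  have "hermite_dd G T (a + 1) L = hermite_dd H T (a + 1) L"
    by (rule Suc.IH, rule Suc.prems) auto
  moreover have "hermite_dd G T a L = hermite_dd H T a L"
    by (rule Suc.IH, rule Suc.prems) auto
  moreover have "G (Suc L) (T a) = H (Suc L) (T a)" if "T a = T (a + int (Suc L))"
    using Suc.prems[of a "Suc L"] that by simp
  ultimately show ?case by (simp del: of_nat_Suc)
qed

lemma hermite_dd_tendsto:
  assumes "\<And>b l. a \<le> b \<Longrightarrow> b + int l \<le> a + int L \<Longrightarrow>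
             ((\<lambda>x. G x l (T b)) \<longlongrightarrow> H l (T b)) F"
  shows "((\<lambda>x. hermite_dd (G x) T a L) \<longlongrightarrow> hermite_dd H T a L) F"
  using assms
proof (induction L arbitrary: a)
  case 0
  show ?case using 0[of a 0] by simp
next
  case (Suc L)
  have "((\<lambda>x. hermite_dd (G x) T (a + 1) L) \<longlongrightarrow> hermite_dd H T (a + 1) L) F"
    by (rule Suc.IH, rule Suc.prems) auto
  moreover have "((\<lambda>x. hermite_dd (G x) T a L) \<longlongrightarrow> hermite_dd H T a L) F"
    by (rule Suc.IH, rule Suc.prems) auto
  moreover have "((\<lambda>x. G x (Suc L) (T a)) \<longlongrightarrow> H (Suc L) (T a)) F"
    using Suc.prems[of a "Suc L"] by simp
  ultimately show ?case
    by (auto simp del: of_nat_Suc intro!: tendsto_intros)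
qed

lemma hermite_dd_has_derivative:
  assumes "\<And>b l. a \<le> b \<Longrightarrow> b + int l \<le> a + int L \<Longrightarrow> T b = T (b + int l) \<Longrightarrow>
             ((\<lambda>x. G x l (T b)) has_real_derivative H l (T b)) (at x0 within S)"
  shows "((\<lambda>x. hermite_dd (G x) T a L) has_real_derivative hermite_dd H T a L) (at x0 within S)"
  using assms
proof (induction L arbitrary: a)
  case 0
  show ?case using 0[of a 0] by simp
next
  case (Suc L)
  have "((\<lambda>x. hermite_dd (G x) T (a + 1) L) has_real_derivative hermite_dd H T (a + 1) L) (at x0 within S)"
    by (rule Suc.IH, rule Suc.prems) auto
  moreover have "((\<lambda>x. hermite_dd (G x) T a L) has_real_derivative hermite_dd H T a L) (at x0 within S)"
    by (rule Suc.IH, rule Suc.prems) auto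
  moreover have "((\<lambda>x. G x (Suc L) (T a)) has_real_derivative H (Suc L) (T a)) (at x0 within S)"
    if "T a = T (a + int (Suc L))"
    using Suc.prems[of a "Suc L"] that by simp
  ultimately show ?case
    by (cases "T a = T (a + int (Suc L))")
       (simp_all del: of_nat_Suc fact_Suc add: DERIV_diff DERIV_cdivide)
qed

section \<open>Polynomials with a cut-off\<close>

text \<open>The Hermite data of a polynomial multiplied by a locally constant weight, such as the cut-off
  \<open>(y - s)\<^sub>+\<^sup>0\<close>; the weight is never differentiated.\<close>

definition weighted_jet :: "(real \<Rightarrow> real) \<Rightarrow> real poly \<Rightarrow> nat \<Rightarrow> real \<Rightarrow> real" where
  "weighted_jet w p l y = w y * poly ((pderiv ^^ l) p) y"

lemma pderiv_funpow_eq_0: "degree (p :: real poly) < l \<Longrightarrow> (pderiv ^^ l) p = 0"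
  by (rule poly_eqI) (simp add: coeff_higher_pderiv coeff_eq_0)

lemma pderiv_linear: "pderiv [:- c, 1:] = (1 :: real poly)"
  by (simp add: pderiv_pCons)

lemma pderiv_funpow_linear_mult:
  "(pderiv ^^ Suc l) ([:- c, 1:] * p) =
     [:- c, 1:] * (pderiv ^^ Suc l) p + smult (real (Suc l)) ((pderiv ^^ l) p)"
proof (induction l)
  case 0
  show ?case by (simp add: pderiv_mult pderiv_linear del: mult_pCons_left)
next
  case (Suc l)
  have "(pderiv ^^ Suc (Suc l)) ([:- c, 1:] * p) =
    pderiv ([:- c, 1:] * (pderiv ^^ Suc l) p + smult (real (Suc l)) ((pderiv ^^ l) p))"
    using Suc by simp
  also have "\<dots> = [:- c, 1:] * (pderiv ^^ Suc (Suc l)) p + (pderiv ^^ Suc l) p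
      + smult (real (Suc l)) ((pderiv ^^ Suc l) p)"
    by (simp add: pderiv_mult pderiv_add pderiv_smult pderiv_linear del: mult_pCons_left)
  also have "\<dots> = [:- c, 1:] * (pderiv ^^ Suc (Suc l)) p
      + smult (real (Suc (Suc l))) ((pderiv ^^ Suc l) p)"
    unfolding of_nat_Suc[of "Suc l"] smult_add_left by simp
  finally show ?case .
qed

lemma pderiv_funpow_linear_power:
  "l \<le> d \<Longrightarrow> (pderiv ^^ l) ([:- x, 1:] ^ d) =
     smult (fact d / fact (d - l)) ([:- x, 1:] ^ (d - l) :: real poly)"
proof (induction l)
  case (Suc l)
  then obtain e where e: "d - l = Suc e" "d - Suc l = e" by (metis Suc_diff_Suc Suc_le_lessD)
  have "pderiv ([:- x, 1:] ^ Suc e) = smult (real (Suc e)) ([:- x, 1:] ^ e :: real poly)"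
    by (simp only: pderiv_power_Suc pderiv_linear mult_1_right)
  then show ?case using Suc e
    by (simp add: pderiv_smult fact_Suc[of e] field_simps del: power_Suc of_nat_Suc fact_Suc)
qed simp

lemma poly_pderiv_funpow_linear_power:
  "poly ((pderiv ^^ l) ([:- x, 1:] ^ d)) y =
     (if l \<le> d then fact d / fact (d - l) * (y - x :: real) ^ (d - l) else 0)"
  by (simp add: pderiv_funpow_linear_power pderiv_funpow_eq_0 degree_linear_power)

lemma poly_pderiv_funpow_root:
  assumes "[:- y, 1:] ^ Suc l dvd (p :: real poly)"
  shows "poly ((pderiv ^^ l) p) y = 0"
proof -
  have "[:- y, 1:] ^ (Suc e) dvd (pderiv ^^ l) p" if "[:- y, 1:] ^ Suc (l + e) dvd p" for e
    using that
  proof (induction l arbitrary: e)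
    case (Suc l)
    have "[:- y, 1:] ^ Suc (Suc e) dvd (pderiv ^^ l) p"
      using Suc.IH[of "Suc e"] Suc.prems by simp
    then obtain q where q: "(pderiv ^^ l) p = [:- y, 1:] ^ Suc (Suc e) * q" by (rule dvdE)
    have "pderiv ([:- y, 1:] ^ Suc (Suc e) * q) =
      [:- y, 1:] ^ Suc e * ([:- y, 1:] * pderiv q + smult (real (Suc (Suc e))) q)"
      unfolding pderiv_mult pderiv_power_Suc[of _ "Suc e"] pderiv_linear
      by (simp only: power_Suc[of _ "Suc e"] mult_smult_left mult_smult_right distrib_left
            mult_1_left mult_1_right ac_simps)
    then show ?case using q by (metis dvd_triv_left funpow.simps(2) o_apply)
  qed simp
  from this[of 0] assms have "[:- y, 1:] dvd (pderiv ^^ l) p" by simp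
  then show ?thesis by (simp add: poly_eq_0_iff_dvd)
qed

lemma mono_squeeze:
  assumes "mono (T :: int \<Rightarrow> real)" "T a = T b" "a \<le> c" "c \<le> b"
  shows "T c = T a"
  using assms by (metis monoD order_antisym)

section \<open>B-splines as divided differences of truncated powers\<close>

text \<open>If all nodes coincide, the two divided differences on the right are the same derivative (up
  to the factorial), so the identity survives a zero denominator.\<close>

lemma hermite_dd_eq_diff:
  assumes "mono T"
  shows "(T (a + int (Suc L)) - T a) * hermite_dd G T a (Suc L) =
           hermite_dd G T (a + 1) L - hermite_dd G T a L"
proof (cases "T a = T (a + int (Suc L))")
  case True
  have "T (a + 1) = T a" "T (a + int L) = T a" "T (a + 1 + int L) = T a"
    by (rule mono_squeeze[OF assms True]; simp)+
  then have "hermite_dd G T (a + 1) L = hermite_dd G T a L" by (cases L) simp_all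
  then show ?thesis using True by simp
qed simp

declare hermite_dd.simps(2) [simp del]

text \<open>The Leibniz rule for divided differences, in the case where one factor is linear and therefore
  has only two nonzero divided differences, \<open>T a - c\<close> and \<open>1\<close>.\<close>

lemma hermite_dd_linear_mult:
  assumes "mono T"
  shows "hermite_dd (weighted_jet w ([:- c, 1:] * p)) T a (Suc L) =
     (T a - c) * hermite_dd (weighted_jet w p) T a (Suc L) + hermite_dd (weighted_jet w p) T (a + 1) L"
proof (induction L arbitrary: a)
  case 0
  have "(pderiv ^^ Suc 0) ([:- c, 1:] * p) = [:- c, 1:] * pderiv p + p"
    unfolding pderiv_funpow_linear_mult by simp
  then have 1: "poly (pderiv ([:- c, 1:] * p)) y = (y - c) * poly (pderiv p) y + poly p y" for y
    by (simp add: left_diff_distrib del: mult_pCons_left)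
  have 2: "poly ([:- c, 1:] * p) y = (y - c) * poly p y" for y
    by (simp add: algebra_simps)
  show ?case
    by (simp add: hermite_dd.simps(2) weighted_jet_def 1 2 divide_simps del: mult_pCons_left) (simp add: algebra_simps)
next
  case (Suc L)
  let ?D = "hermite_dd (weighted_jet w p) T"
  let ?D' = "hermite_dd (weighted_jet w ([:- c, 1:] * p)) T"
  show ?case
  proof (cases "T a = T (a + int (Suc (Suc L)))")
    case True
    then have eq: "T (a + 1) = T a" "T (a + 1 + int (Suc L)) = T a"
      using mono_squeeze[OF assms True, of "a + 1"] by (auto simp: algebra_simps)
    have f: "fact (Suc (Suc L)) = real (Suc (Suc L)) * fact (Suc L)" by (rule fact_Suc)
    show ?thesis
      unfolding hermite_dd.simps(2)[of _ T a "Suc L"] hermite_dd.simps(2)[of _ T "a + 1" L]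
        weighted_jet_def pderiv_funpow_linear_mult f
      using True eq by (simp add: divide_simps del: fact_Suc of_nat_Suc funpow.simps)
        (simp add: algebra_simps del: fact_Suc of_nat_Suc funpow.simps)
  next
    case False
    let ?e = "T (a + int (Suc (Suc L))) - T a"
    have idx: "a + 1 + int (Suc L) = a + int (Suc (Suc L))" by simp
    have "?e * ?D' a (Suc (Suc L)) = ?D' (a + 1) (Suc L) - ?D' a (Suc L)"
      by (rule hermite_dd_eq_diff[OF assms])
    also have "\<dots> = (T (a + 1) - c) * ?D (a + 1) (Suc L) - (T a - c) * ?D a (Suc L)
        + (?D (a + 1 + 1) L - ?D (a + 1) L)"
      unfolding Suc.IH by simp
    also have "?D (a + 1 + 1) L - ?D (a + 1) L =
        (T (a + int (Suc (Suc L))) - T (a + 1)) * ?D (a + 1) (Suc L)"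
      unfolding idx[symmetric] by (rule hermite_dd_eq_diff[OF assms, symmetric])
    also have "(T (a + 1) - c) * ?D (a + 1) (Suc L) - (T a - c) * ?D a (Suc L) + \<dots> =
        (T a - c) * (?D (a + 1) (Suc L) - ?D a (Suc L)) + ?e * ?D (a + 1) (Suc L)"
      by (simp add: algebra_simps)
    also have "?D (a + 1) (Suc L) - ?D a (Suc L) = ?e * ?D a (Suc (Suc L))"
      by (rule hermite_dd_eq_diff[OF assms, symmetric])
    also have "(T a - c) * (?e * ?D a (Suc (Suc L))) + ?e * ?D (a + 1) (Suc L) =
        ?e * ((T a - c) * ?D a (Suc (Suc L)) + ?D (a + 1) (Suc L))"
      by (simp add: algebra_simps)
    finally show ?thesis using False by simp
  qed
qed

text \<open>The convention \<open>x / 0 = 0\<close> is consistent: if all nodes coincide, the divided difference is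
  a derivative of order \<open>d + 1\<close> of a polynomial of degree \<open>d\<close>.\<close>

lemma hermite_dd_linear_power_divide:
  assumes "mono T"
  shows "hermite_dd (weighted_jet w ([:- x, 1:] ^ d)) T a (Suc d) =
    (T (a + int (Suc d)) - T a) * hermite_dd (weighted_jet w ([:- x, 1:] ^ d)) T a (Suc d)
      / (T (a + int (Suc d)) - T a)"
proof (cases "T a = T (a + int (Suc d))")
  case True
  have "poly ((pderiv ^^ Suc d) ([:- x, 1:] ^ d)) (T a) = 0"
    unfolding poly_pderiv_funpow_linear_power by simp
  then show ?thesis using True by (simp add: hermite_dd.simps(2) weighted_jet_def del: of_nat_Suc funpow.simps)
qed (simp)

text \<open>The induction step multiplies \<open>(y - x)\<^sub>+\<^sup>d\<close> by \<open>y - x\<close>; by the Leibniz rule, its coefficients are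
  those of the Cox--de Boor recursion.\<close>

lemma bspline_rec_eq_hermite_dd:
  assumes "mono T"
  shows "bspline_rec T i d x =
    (T (i + int (Suc d)) - T i) *
      hermite_dd (weighted_jet (\<lambda>y. of_bool (x < y)) ([:- x, 1:] ^ d)) T i (Suc d)"
proof (induction d arbitrary: i)
  case 0
  have "T i \<le> T (i + 1)" using assms by (auto intro: monoD)
  then show ?case
    unfolding hermite_dd_eq_diff[OF assms] by (auto simp: weighted_jet_def)
next
  case (Suc d)
  let ?w = "\<lambda>y. of_bool (x < y)"
  let ?D = "hermite_dd (weighted_jet ?w ([:- x, 1:] ^ d)) T"
  have IH: "?D a (Suc d) = bspline_rec T a d x / (T (a + int (Suc d)) - T a)" for a
    unfolding Suc.IH by (rule hermite_dd_linear_power_divide[OF assms])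
  have idx: "i + 1 + int (Suc d) = i + int (Suc (Suc d))" "i + int (Suc d) + 1 = i + int (Suc (Suc d))"
    by simp_all
  have "(T (i + int (Suc (Suc d))) - T i) *
      hermite_dd (weighted_jet ?w ([:- x, 1:] ^ Suc d)) T i (Suc (Suc d)) =
     (T i - x) * ((T (i + int (Suc (Suc d))) - T i) * ?D i (Suc (Suc d)))
      + (T (i + int (Suc (Suc d))) - T i) * ?D (i + 1) (Suc d)"
    unfolding power_Suc hermite_dd_linear_mult[OF assms]
    by (simp add: algebra_simps del: of_nat_Suc)
  also have "\<dots> = (x - T i) * ?D i (Suc d) + (T (i + int (Suc (Suc d))) - x) * ?D (i + 1) (Suc d)"
    unfolding hermite_dd_eq_diff[OF assms]
    by (simp add: algebra_simps del: of_nat_Suc)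
  also have "\<dots> = bspline_rec T i (Suc d) x"
    unfolding IH bspline_rec.simps idx by simp
  finally show ?case by (rule sym)
qed

section \<open>Marsden's identity and knot insertion\<close>

lemma bspline_rec_support:
  assumes "mono T" "bspline_rec T i d x \<noteq> 0"
  shows "T i \<le> x" "x < T (i + int (Suc d))"
proof -
  have "T i \<le> x \<and> x < T (i + int (Suc d))"
    using assms(2)
  proof (induction d arbitrary: i)
    case 0
    then show ?case by (simp split: if_splits)
  next
    case (Suc d)
    have "T i \<le> T (i + 1)" "T (i + int (Suc d)) \<le> T (i + int (Suc (Suc d)))"
      using assms(1) by (auto intro: monoD)
    moreover have "T (i + 1 + int (Suc d)) = T (i + int (Suc (Suc d)))" by (simp add: algebra_simps)
    moreover have "bspline_rec T i d x \<noteq> 0 \<or> bspline_rec T (i + 1) d x \<noteq> 0"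
      using Suc.prems by auto
    ultimately show ?case using Suc.IH[of i] Suc.IH[of "i + 1"] by linarith
  qed
  then show "T i \<le> x" "x < T (i + int (Suc d))" by auto
qed

text \<open>The polynomials \<open>\<psi>\<^sub>i\<close> of Marsden's identity, with zeros at the inner knots of the \<open>i\<close>-th B-spline
  of degree \<open>d\<close>.\<close>

definition dual_poly :: "(int \<Rightarrow> real) \<Rightarrow> nat \<Rightarrow> int \<Rightarrow> real poly" where
  "dual_poly T d i = (\<Prod>r=1..d. [:- T (i + int r), 1:])"

lemma dual_poly_Suc: "dual_poly T (Suc d) i = dual_poly T d i * [:- T (i + int (Suc d)), 1:]"
  by (simp add: dual_poly_def)

lemma dual_poly_Suc_left: "dual_poly T (Suc d) (i - 1) = [:- T i, 1:] * dual_poly T d i"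
proof -
  have "dual_poly T (Suc d) (i - 1) =
    [:- T i, 1:] * (\<Prod>r=Suc 1..Suc d. [:- T (i - 1 + int r), 1:])"
    unfolding dual_poly_def by (subst prod.atLeast_Suc_atMost) simp_all
  also have "(\<Prod>r=Suc 1..Suc d. [:- T (i - 1 + int r), 1:]) = dual_poly T d i"
    unfolding dual_poly_def prod.shift_bounds_cl_Suc_ivl by simp
  finally show ?thesis .
qed

text \<open>After insertion of the recursion, the two contributions of each B-spline of degree \<open>d\<close> combine by
  \<open>(x - T i) (y - T (i + d + 1)) + (T (i + d + 1) - x) (y - T i) = (T (i + d + 1) - T i) (y - x)\<close>.\<close>

lemma marsden_window:
  assumes "mono T" "T \<nu> \<le> x" "x < T (\<nu> + 1)"
  shows "(\<Sum>i=\<nu> - int d..\<nu>. bspline_rec T i d x * poly (dual_poly T d i) y) = (y - x) ^ d"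
proof (induction d)
  case 0
  then show ?case using assms by (simp add: dual_poly_def)
next
  case (Suc d)
  define A where "A i = bspline_rec T i d x / (T (i + int (Suc d)) - T i)" for i
  have A: "A i * (T (i + int (Suc d)) - T i) = bspline_rec T i d x" for i
    using bspline_rec_support[OF assms(1), of i d x] by (cases "bspline_rec T i d x = 0") (auto simp: A_def)
  let ?p = "\<lambda>i. poly (dual_poly T (Suc d) i) y"
  have rec: "bspline_rec T i (Suc d) x = (x - T i) * A i + (T (i + 1 + int (Suc d)) - x) * A (i + 1)"
    for i by (simp add: A_def algebra_simps)
  \<comment> \<open>The supports of these two neighbours of the window do not contain \<open>x\<close>, so after the shift of
    one sum both run over the window of degree \<open>d\<close>.\<close>
  have 0: "A (\<nu> - int (Suc d)) = 0" "A (\<nu> + 1) = 0"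
    using bspline_rec_support[OF assms(1), of "\<nu> - int (Suc d)" d x]
      bspline_rec_support[OF assms(1), of "\<nu> + 1" d x] assms(2,3)
    by (auto simp: A_def simp del: of_nat_Suc)
  have "(\<Sum>i=\<nu> - int (Suc d)..\<nu>. bspline_rec T i (Suc d) x * ?p i) =
      (\<Sum>i=\<nu> - int (Suc d)..\<nu>. (x - T i) * A i * ?p i)
      + (\<Sum>i=\<nu> - int (Suc d)..\<nu>. (T (i + 1 + int (Suc d)) - x) * A (i + 1) * ?p i)"
    unfolding rec by (simp only: distrib_right sum.distrib)
  also have "(\<Sum>i=\<nu> - int (Suc d)..\<nu>. (x - T i) * A i * ?p i) =
      (\<Sum>i=\<nu> - int d..\<nu>. (x - T i) * A i * ?p i)"
  proof (rule sum.mono_neutral_right)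
    have "A i = 0" if "i \<in> {\<nu> - int (Suc d)..\<nu>} - {\<nu> - int d..\<nu>}" for i
    proof -
      have "i = \<nu> - int (Suc d)" using that by auto
      then show ?thesis using 0 by simp
    qed
    then have "(x - T i) * A i * ?p i = 0"
      if "i \<in> {\<nu> - int (Suc d)..\<nu>} - {\<nu> - int d..\<nu>}" for i
      using that by (simp only: mult_zero_left mult_zero_right)
    then show "\<forall>i\<in>{\<nu> - int (Suc d)..\<nu>} - {\<nu> - int d..\<nu>}. (x - T i) * A i * ?p i = 0"
      by blast
  qed auto
  also have "(\<Sum>i=\<nu> - int (Suc d)..\<nu>. (T (i + 1 + int (Suc d)) - x) * A (i + 1) * ?p i) =
      (\<Sum>i=\<nu> - int d..\<nu> + 1. (T (i + int (Suc d)) - x) * A i * ?p (i - 1))"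
    by (rule sum.reindex_bij_witness[of _ "\<lambda>i. i - 1" "\<lambda>i. i + 1"]) auto
  also have "\<dots> = (\<Sum>i=\<nu> - int d..\<nu>. (T (i + int (Suc d)) - x) * A i * ?p (i - 1))"
  proof (rule sum.mono_neutral_right)
    have "i = \<nu> + 1" if "i \<in> {\<nu> - int d..\<nu> + 1} - {\<nu> - int d..\<nu>}" for i
      using that by auto
    then show "\<forall>i\<in>{\<nu> - int d..\<nu> + 1} - {\<nu> - int d..\<nu>}.
        (T (i + int (Suc d)) - x) * A i * ?p (i - 1) = 0"
      using 0 by fastforce
  qed auto
  also have "(\<Sum>i=\<nu> - int d..\<nu>. (x - T i) * A i * ?p i)
      + (\<Sum>i=\<nu> - int d..\<nu>. (T (i + int (Suc d)) - x) * A i * ?p (i - 1)) =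
      (\<Sum>i=\<nu> - int d..\<nu>. (y - x) * (bspline_rec T i d x * poly (dual_poly T d i) y))"
    unfolding sum.distrib[symmetric]
  proof (rule sum.cong)
    fix i
    show "(x - T i) * A i * ?p i + (T (i + int (Suc d)) - x) * A i * ?p (i - 1) =
      (y - x) * (bspline_rec T i d x * poly (dual_poly T d i) y)"
      unfolding A[of i, symmetric] dual_poly_Suc_left unfolding dual_poly_Suc
      by (simp add: algebra_simps del: of_nat_Suc)
  qed simp
  also have "\<dots> = (y - x) ^ Suc d"
    unfolding sum_distrib_left[symmetric] Suc.IH by simp
  finally show ?case .
qed

lemma marsden_poly:
  assumes "mono T" "T \<nu> \<le> x" "x < T (\<nu> + 1)" "lo \<le> \<nu> - int d" "\<nu> \<le> hi"
  shows "[:- x, 1:] ^ d = (\<Sum>i=lo..hi. smult (bspline_rec T i d x) (dual_poly T d i))"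
proof (rule poly_ext)
  fix y
  have "(\<Sum>i=lo..hi. bspline_rec T i d x * poly (dual_poly T d i) y) =
      (\<Sum>i=\<nu> - int d..\<nu>. bspline_rec T i d x * poly (dual_poly T d i) y)"
  proof (rule sum.mono_neutral_right)
    have "bspline_rec T i d x = 0" if "i \<notin> {\<nu> - int d..\<nu>}" for i
    proof (rule ccontr)
      assume nz: "bspline_rec T i d x \<noteq> 0"
      have "\<nu> + 1 \<le> i \<or> i + int (Suc d) \<le> \<nu>" using that by auto
      then have "T (\<nu> + 1) \<le> T i \<or> T (i + int (Suc d)) \<le> T \<nu>"
        using monoD[OF assms(1)] by blast
      then show False
        using bspline_rec_support[OF assms(1) nz] assms(2,3) by auto
    qed
    then show "\<forall>i\<in>{lo..hi} - {\<nu> - int d..\<nu>}. bspline_rec T i d x * poly (dual_poly T d i) y = 0"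
      by auto
  qed (use assms in auto)
  then show "poly ([:- x, 1:] ^ d) y =
      poly (\<Sum>i=lo..hi. smult (bspline_rec T i d x) (dual_poly T d i)) y"
    using marsden_window[OF assms(1-3), of d y] by (simp add: poly_sum)
qed

text \<open>All \<open>l + 1\<close> indices \<open>c, \<dots>, c + l\<close> of the knot \<open>y\<close> lie strictly between \<open>i\<close> and \<open>i + d + 1\<close>
  because \<open>y\<close> is strictly between the outer knots; so \<open>y\<close> is a root of multiplicity at least \<open>l + 1\<close>.\<close>

lemma poly_pderiv_funpow_dual_poly_eq_0:
  assumes "mono T" "T i < y" "y < T (i + int (Suc d))" "T c = y" "T (c + int l) = y"
  shows "poly ((pderiv ^^ l) (dual_poly T d i)) y = 0"
proof (rule poly_pderiv_funpow_root)
  have "i < c" using assms(2,4) monoD[OF assms(1), of c i] by fastforce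
  moreover have "c + int l < i + int (Suc d)"
    using assms(3,5) monoD[OF assms(1), of "i + int (Suc d)" "c + int l"] by fastforce
  moreover define a where "a = nat (c - i)"
  ultimately have a: "1 \<le> a" "a + l \<le> d" "c = i + int a" by auto
  have "[:- T (i + int r), 1:] = [:- y, 1:]" if "r \<in> {a..a + l}" for r
    using mono_squeeze[OF assms(1), of c "c + int l" "i + int r"] assms(4,5) a that by auto
  then have "(\<Prod>r=a..a + l. [:- T (i + int r), 1:]) = (\<Prod>r=a..a + l. [:- y, 1:])"
    by (rule prod.cong[OF refl])
  then have "[:- y, 1:] ^ Suc l = (\<Prod>r=a..a + l. [:- T (i + int r), 1:])"
    by simp
  also have "\<dots> dvd dual_poly T d i"
    unfolding dual_poly_def by (rule prod_dvd_prod_subset) (use a in auto)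
  finally show "[:- y, 1:] ^ Suc l dvd dual_poly T d i" .
qed

text \<open>The condition that \<open>T\<close> refines \<open>T'\<close> concerns only knots strictly inside the range of \<open>T\<close>: the
  cut-offs at \<open>x\<close> and at \<open>s i\<close>, both of which lie in the support of the \<open>i\<close>-th B-spline, can disagree
  only at such a knot. There the polynomial \<open>\<psi>\<^sub>i\<close> has a zero of sufficient order.\<close>

lemma bspline_rec_knot_insertion:
  fixes T T' :: "int \<Rightarrow> real" and s :: "int \<Rightarrow> real"
  assumes "mono T" "mono T'"
    and x: "T \<nu> \<le> x" "x < T (\<nu> + 1)" "lo \<le> \<nu> - int d" "\<nu> \<le> hi"
    and refines: "\<And>b l. T lo < T' b \<Longrightarrow> T' b < T (hi + int (Suc d)) \<Longrightarrow> T' b = T' (b + int l) \<Longrightarrow>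
      \<exists>c. T c = T' b \<and> T (c + int l) = T' b"
    and s: "\<And>i. lo \<le> i \<Longrightarrow> i \<le> hi \<Longrightarrow> T i \<le> s i \<and> s i < T (i + int (Suc d))"
  shows "bspline_rec T' a d x =
    (\<Sum>i=lo..hi. (T' (a + int (Suc d)) - T' a) *
       hermite_dd (weighted_jet (\<lambda>y. of_bool (s i < y)) (dual_poly T d i)) T' a (Suc d) * bspline_rec T i d x)"
proof -
  have "hermite_dd (weighted_jet (\<lambda>y. of_bool (x < y)) ([:- x, 1:] ^ d)) T' a (Suc d) =
    hermite_dd (\<lambda>l y. \<Sum>i=lo..hi. bspline_rec T i d x *
      weighted_jet (\<lambda>y. of_bool (s i < y)) (dual_poly T d i) l y) T' a (Suc d)"
  proof (rule hermite_dd_cong)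
    fix b l
    assume bl: "T' b = T' (b + int l)"
    let ?y = "T' b"
    have "of_bool (x < ?y) * (bspline_rec T i d x * poly ((pderiv ^^ l) (dual_poly T d i)) ?y) =
        bspline_rec T i d x * (of_bool (s i < ?y) * poly ((pderiv ^^ l) (dual_poly T d i)) ?y)"
      if i: "i \<in> {lo..hi}" for i
    proof (cases "bspline_rec T i d x = 0 \<or> (x < ?y) = (s i < ?y)")
      case False
      then have *: "T i < ?y" "?y < T (i + int (Suc d))"
        using bspline_rec_support[OF assms(1), of i d x] s[of i] i by auto
      moreover have "T lo \<le> T i" "T (i + int (Suc d)) \<le> T (hi + int (Suc d))"
        using i assms(1) by (auto intro: monoD)
      ultimately obtain c where "T c = ?y" "T (c + int l) = ?y"
        using refines[of b l] bl by auto
      from poly_pderiv_funpow_dual_poly_eq_0[OF assms(1) * this] show ?thesis by simp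
    qed auto
    then show "weighted_jet (\<lambda>y. of_bool (x < y)) ([:- x, 1:] ^ d) l ?y =
      (\<Sum>i=lo..hi. bspline_rec T i d x * weighted_jet (\<lambda>y. of_bool (s i < y)) (dual_poly T d i) l ?y)"
      unfolding marsden_poly[OF assms(1) x] weighted_jet_def higher_pderiv_sum higher_pderiv_smult
        poly_sum poly_smult sum_distrib_left
      by (rule sum.cong[OF refl])
  qed
  then show ?thesis
    unfolding bspline_rec_eq_hermite_dd[OF assms(2)] hermite_dd_sum
    by (simp add: sum_distrib_left mult_ac)
qed

section \<open>Divided differences with derivatives from the left\<close>

text \<open>At the jump itself the weight is \<open>0\<close>, which agrees with the values immediately to the left; so
  the left derivative is a cut-off polynomial again and can be iterated.\<close>

lemma left_deriv_cut_poly: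
  "left_deriv (\<lambda>y. of_bool (s < y) * poly p y) = (\<lambda>y. of_bool (s < y) * poly (pderiv p) y)"
proof
  fix x
  have "((\<lambda>y. of_bool (s < y) * poly p y) has_real_derivative of_bool (s < x) * poly (pderiv p) x)
    (at x within {..<x})"
  proof (cases "s < x")
    case True
    have "(poly p has_real_derivative poly (pderiv p) x) (at x)" by (rule poly_DERIV)
    then have "((\<lambda>y. of_bool (s < y) * poly p y) has_real_derivative poly (pderiv p) x) (at x)"
      by (rule has_field_derivative_transform_within_open[of _ _ _ "{s<..}"]) (use True in auto)
    then show ?thesis using True by (simp add: has_field_derivative_at_within)
  next
    case False
    have "((\<lambda>y. 0 :: real) has_real_derivative 0) (at x within {..<x})" by simp
    then show ?thesis using False
      by (subst has_field_derivative_cong_eventually[where g = "\<lambda>_. 0"])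
         (auto simp: eventually_at_filter)
  qed
  then show "left_deriv (\<lambda>y. of_bool (s < y) * poly p y) x = of_bool (s < x) * poly (pderiv p) x"
    unfolding left_deriv_def has_real_derivative_iff_has_vector_derivative
    by (rule vector_derivative_within[rotated]) (rule trivial_limit_at_left_real)
qed

lemma divdiff_cut_poly:
  "divdiff (\<lambda>y. of_bool (s < y) * poly p y) T a L = hermite_dd (weighted_jet (\<lambda>y. of_bool (s < y)) p) T a L"
proof -
  have jet: "(left_deriv ^^ l) (\<lambda>y. of_bool (s < y) * poly p y) =
      (\<lambda>y. of_bool (s < y) * poly ((pderiv ^^ l) p) y)" for l
    by (induction l) (simp_all add: left_deriv_cut_poly)
  show ?thesis
    by (induction L arbitrary: a)
       (simp_all only: divdiff.simps hermite_dd.simps jet weighted_jet_def funpow_0)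
qed

section \<open>B-splines on the closed unit interval\<close>

text \<open>Values at \<open>x = 1\<close> are limits from the left, and for \<open>x < 1\<close> a knot \<open>y = 1\<close> lies to the right of
  \<open>x\<close>. Counting knots \<open>y \<ge> 1\<close> as lying to the right of \<open>x = 1\<close> as well makes the divided difference
  formula hold on all of \<open>[0,1]\<close>.\<close>

abbreviation cut01 :: "real \<Rightarrow> real \<Rightarrow> real" where
  "cut01 x y \<equiv> of_bool (x < y \<or> 1 \<le> y)"

lemma bspline_rec_eq_cut01:
  assumes "mono T" "x < 1"
  shows "bspline_rec T i d x =
    (T (i + int (Suc d)) - T i) * hermite_dd (weighted_jet (cut01 x) ([:- x, 1:] ^ d)) T i (Suc d)"
proof -
  have "(\<lambda>y. of_bool (x < y)) = cut01 x" using assms(2) by auto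
  then show ?thesis using bspline_rec_eq_hermite_dd[OF assms(1), of i d x] by simp
qed

lemma bspline_rec_tendsto_at_left_1:
  assumes "mono T"
  shows "(bspline_rec T i d \<longlongrightarrow>
    (T (i + int (Suc d)) - T i) * hermite_dd (weighted_jet (cut01 1) ([:- 1, 1:] ^ d)) T i (Suc d)) (at_left 1)"
proof -
  have "((\<lambda>x. weighted_jet (cut01 x) ([:- x, 1:] ^ d) l y) \<longlongrightarrow> weighted_jet (cut01 1) ([:- 1, 1:] ^ d) l y) (at_left 1)"
    for l and y :: real
  proof (cases "1 \<le> y")
    case True
    then show ?thesis unfolding weighted_jet_def poly_pderiv_funpow_linear_power
      by (auto intro!: tendsto_eq_intros)
  next
    case False
    then have "\<forall>\<^sub>F x in at_left 1. y < x"
      by (intro eventually_at_leftI[of "max y 0"]) auto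
    then have "\<forall>\<^sub>F x in at_left 1. weighted_jet (cut01 x) ([:- x, 1:] ^ d) l y = 0"
      by eventually_elim (use False in \<open>auto simp: weighted_jet_def\<close>)
    then show ?thesis using False by (auto simp: weighted_jet_def intro: tendsto_eventually)
  qed
  then have "((\<lambda>x. (T (i + int (Suc d)) - T i) *
        hermite_dd (weighted_jet (cut01 x) ([:- x, 1:] ^ d)) T i (Suc d)) \<longlongrightarrow>
      (T (i + int (Suc d)) - T i) * hermite_dd (weighted_jet (cut01 1) ([:- 1, 1:] ^ d)) T i (Suc d)) (at_left 1)"
    by (intro tendsto_mult tendsto_const hermite_dd_tendsto)
  moreover have "\<forall>\<^sub>F x in at_left 1. bspline_rec T i d x = (T (i + int (Suc d)) - T i) *
        hermite_dd (weighted_jet (cut01 x) ([:- x, 1:] ^ d)) T i (Suc d)"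
    by (auto simp: eventually_at_filter bspline_rec_eq_cut01[OF assms])
  ultimately show ?thesis by (simp add: tendsto_cong)
qed

lemma bspline_eq_hermite_dd:
  assumes "mono T" "x \<le> 1"
  shows "bspline T i d x =
    (T (i + int (Suc d)) - T i) * hermite_dd (weighted_jet (cut01 x) ([:- x, 1:] ^ d)) T i (Suc d)"
proof (cases "x = 1")
  case True
  then show ?thesis
    using tendsto_Lim[OF trivial_limit_at_left_real bspline_rec_tendsto_at_left_1[OF assms(1)]]
    by (simp add: bspline_def)
next
  case False
  then show ?thesis using bspline_rec_eq_cut01[OF assms(1), of x i d] assms(2)
    by (simp add: bspline_def)
qed

lemma bspline_rec_tendsto_bspline:
  assumes "mono T"
  shows "(bspline_rec T i d \<longlongrightarrow> bspline T i d 1) (at_left 1)"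
  using bspline_rec_tendsto_at_left_1[OF assms] bspline_eq_hermite_dd[OF assms, of 1] by simp

lemma DERIV_power_diff:
  fixes x y :: real
  shows "((\<lambda>x. (y - x) ^ Suc k) has_real_derivative - real (Suc k) * (y - x) ^ k) (at x within S)"
proof -
  have "((\<lambda>x. y - x) has_real_derivative - 1) (at x within S)"
    by (auto intro!: derivative_eq_intros)
  from DERIV_power[OF this, of "Suc k"] show ?thesis by (rule DERIV_cong) (simp del: of_nat_Suc)
qed

lemma DERIV_truncated_power:
  fixes x y :: real
  shows "((\<lambda>x. of_bool (x < y) * (y - x) ^ Suc (Suc k)) has_real_derivative
    - real (Suc (Suc k)) * (of_bool (x < y) * (y - x) ^ Suc k)) (at x)"
proof -
  consider "x < y" | "x = y" | "y < x" by linarith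
  then show ?thesis
  proof cases
    case 1
    have "((\<lambda>x. (y - x) ^ Suc (Suc k)) has_real_derivative
        - real (Suc (Suc k)) * (y - x) ^ Suc k) (at x)"
      by (rule DERIV_power_diff)
    then have "((\<lambda>x. of_bool (x < y) * (y - x) ^ Suc (Suc k)) has_real_derivative
        - real (Suc (Suc k)) * (y - x) ^ Suc k) (at x)"
      by (rule has_field_derivative_transform_within_open[of _ _ _ "{..<y}"]) (use 1 in auto)
    then show ?thesis using 1 by simp
  next
    case 2
    have "isCont (\<lambda>z. - (max 0 (y - z) ^ Suc k)) y" by (intro continuous_intros)
    moreover have "of_bool (z < y) * (y - z) ^ Suc (Suc k) = - (max 0 (y - z) ^ Suc k) * (z - y)" for z
      by (cases "z < y") (auto simp: max_def algebra_simps)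
    ultimately have "((\<lambda>x. of_bool (x < y) * (y - x) ^ Suc (Suc k)) has_real_derivative 0) (at y)"
      unfolding CARAT_DERIV by (intro exI[of _ "\<lambda>z. - (max 0 (y - z) ^ Suc k)"]) auto
    then show ?thesis using 2 by simp
  next
    case 3
    have "((\<lambda>x. 0 :: real) has_real_derivative 0) (at x)" by simp
    then have "((\<lambda>x. of_bool (x < y) * (y - x) ^ Suc (Suc k)) has_real_derivative 0) (at x)"
      by (rule has_field_derivative_transform_within_open[of _ _ _ "{y<..}"]) (use 3 in auto)
    then show ?thesis using 3 by simp
  qed
qed

text \<open>The Hermite data of the truncated power are differentiable in \<open>x\<close>, also at \<open>x = y\<close>, whenever the
  remaining exponent \<open>d + 1 - l\<close> is at least \<open>2\<close>. Nodes outside the open interval are harmless: within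
  \<open>[0,1]\<close> the cut-off is constantly \<open>0\<close> for \<open>y \<le> 0\<close> and constantly \<open>1\<close> for \<open>y \<ge> 1\<close>.\<close>

lemma DERIV_cut01_jet:
  assumes "y \<le> 0 \<or> 1 \<le> y \<or> l < d"
  shows "((\<lambda>x. weighted_jet (cut01 x) ([:- x, 1:] ^ Suc d) l y) has_real_derivative
    - real (Suc d) * weighted_jet (cut01 x) ([:- x, 1:] ^ d) l y) (at x within {0..1})"
    (is "(?f has_real_derivative ?D) _")
proof (cases "x \<in> {0..1}")
  case x: True
  consider "y \<le> 0" | "1 \<le> y" "d < l" | e where "1 \<le> y" "d = l + e"
    | k where "0 < y" "y < 1" "d = Suc (l + k)"
  proof (cases "1 \<le> y")
    case True
    then show ?thesis using that(2) that(3)[of "d - l"] by (cases "d < l") auto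
  next
    case False
    then show ?thesis using that(1) that(4)[of "d - Suc l"] assms by (cases "y \<le> 0") auto
  qed
  then show ?thesis
  proof cases
    case 1
    have "((\<lambda>x. 0) has_real_derivative 0) (at x within {0..1})" by simp
    moreover have "?f z = 0" if "z \<in> {0..1}" for z using 1 that by (simp add: weighted_jet_def)
    ultimately show ?thesis using 1 x
      by (subst has_field_derivative_cong_eventually[where g = "\<lambda>_. 0"])
         (auto simp: eventually_at_filter weighted_jet_def)
  next
    case 2
    have "?f = (\<lambda>_. of_bool (l = Suc d) * fact (Suc d))"
      using 2 by (auto simp: weighted_jet_def poly_pderiv_funpow_linear_power simp del: power_Suc fact_Suc)
    moreover have "?D = 0" using 2 by (simp add: weighted_jet_def poly_pderiv_funpow_linear_power)
    ultimately show ?thesis by simp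
  next
    case 3
    have e: "Suc (l + e) - l = Suc e" "l + e - l = e" "l \<le> Suc (l + e)" "l \<le> l + e" by auto
    have f: "fact (Suc (l + e)) / fact (Suc e) * real (Suc e) =
        real (Suc (l + e)) * (fact (l + e) / fact e :: real)"
      unfolding fact_Suc[of e] fact_Suc[of "l + e"] by (simp del: of_nat_Suc)
    have W: "weighted_jet (cut01 z) ([:- z, 1:] ^ Suc d) l y = fact (Suc (l + e)) / fact (Suc e) * (y - z) ^ Suc e"
      for z using 3 e by (simp add: weighted_jet_def poly_pderiv_funpow_linear_power del: power_Suc fact_Suc)
    have W': "weighted_jet (cut01 x) ([:- x, 1:] ^ d) l y = fact (l + e) / fact e * (y - x) ^ e"
      using 3 e by (simp add: weighted_jet_def poly_pderiv_funpow_linear_power)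
    have "((\<lambda>x. fact (Suc (l + e)) / fact (Suc e) * (y - x) ^ Suc e) has_real_derivative
        fact (Suc (l + e)) / fact (Suc e) * (- real (Suc e) * (y - x) ^ e)) (at x within {0..1})"
      by (intro DERIV_cmult DERIV_power_diff)
    then show ?thesis unfolding W W'
    proof (rule DERIV_cong)
      have "fact (Suc (l + e)) / fact (Suc e) * (- real (Suc e) * (y - x) ^ e) =
          - (fact (Suc (l + e)) / fact (Suc e) * real (Suc e)) * (y - x) ^ e"
        by (simp only: mult_minus_left mult_minus_right mult.assoc)
      then show "fact (Suc (l + e)) / fact (Suc e) * (- real (Suc e) * (y - x) ^ e) =
          - real (Suc d) * (fact (l + e) / fact e * (y - x) ^ e)"
        unfolding f 3(2) by (simp only: mult_minus_left mult_minus_right mult.assoc)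
    qed
  next
    case 4
    have k: "Suc (Suc (l + k)) - l = Suc (Suc k)" "Suc (l + k) - l = Suc k" by auto
    have f: "fact (Suc (Suc (l + k))) / fact (Suc (Suc k)) * real (Suc (Suc k)) =
        real (Suc (Suc (l + k))) * (fact (Suc (l + k)) / fact (Suc k) :: real)"
      unfolding fact_Suc[of "Suc k"] fact_Suc[of "Suc (l + k)"] by (simp del: of_nat_Suc fact_Suc)
    have W: "weighted_jet (cut01 z) ([:- z, 1:] ^ Suc d) l y =
        fact (Suc (Suc (l + k))) / fact (Suc (Suc k)) * (of_bool (z < y) * (y - z) ^ Suc (Suc k))" for z
      using 4 k by (simp add: weighted_jet_def poly_pderiv_funpow_linear_power del: power_Suc fact_Suc)
    have W': "weighted_jet (cut01 x) ([:- x, 1:] ^ d) l y =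
        fact (Suc (l + k)) / fact (Suc k) * (of_bool (x < y) * (y - x) ^ Suc k)"
      using 4 k by (simp add: weighted_jet_def poly_pderiv_funpow_linear_power del: power_Suc fact_Suc)
    have "((\<lambda>x. fact (Suc (Suc (l + k))) / fact (Suc (Suc k)) * (of_bool (x < y) * (y - x) ^ Suc (Suc k)))
        has_real_derivative fact (Suc (Suc (l + k))) / fact (Suc (Suc k)) *
          (- real (Suc (Suc k)) * (of_bool (x < y) * (y - x) ^ Suc k))) (at x within {0..1})"
      by (rule DERIV_cmult[OF has_field_derivative_at_within[OF DERIV_truncated_power]])
    then show ?thesis unfolding W W'
    proof (rule DERIV_cong)
      have "fact (Suc (Suc (l + k))) / fact (Suc (Suc k)) *
            (- real (Suc (Suc k)) * (of_bool (x < y) * (y - x) ^ Suc k)) =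
          - (fact (Suc (Suc (l + k))) / fact (Suc (Suc k)) * real (Suc (Suc k))) *
            (of_bool (x < y) * (y - x) ^ Suc k)"
        by (simp only: mult_minus_left mult_minus_right mult.assoc)
      then show "fact (Suc (Suc (l + k))) / fact (Suc (Suc k)) *
            (- real (Suc (Suc k)) * (of_bool (x < y) * (y - x) ^ Suc k)) =
          - real (Suc d) * (fact (Suc (l + k)) / fact (Suc k) * (of_bool (x < y) * (y - x) ^ Suc k))"
        unfolding f 4(3) by (simp only: mult_minus_left mult_minus_right mult.assoc)
    qed
  qed
next
  case False
  then have "at x within {0..1} = bot"
    by (simp add: at_within_eq_bot_iff closure_closed)
  then show ?thesis by (simp add: has_field_derivative_def has_derivative_bot bounded_linear_mult_right)
qed

lemma has_real_derivative_transform: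
  assumes "x \<in> S" "\<And>z. z \<in> S \<Longrightarrow> g z = f z" "(f has_real_derivative D) (at x within S)"
  shows "(g has_real_derivative D) (at x within S)"
  using assms(3) unfolding has_field_derivative_def
  by (rule has_derivative_transform[OF assms(1), rotated]) (rule assms(2))

text \<open>By \<open>hermite_dd_eq_diff\<close> the B-spline of degree \<open>d + 1\<close> is a difference of two divided
  differences. Differentiating their data lowers the degree by one, and each becomes a B-spline of
  degree \<open>d\<close> divided by the length of its support. Interior knots may have multiplicity at most \<open>d\<close>:
  with \<open>d + 1\<close> the B-spline may have a kink there.\<close>

lemma bspline_has_derivative:
  assumes "mono T" "x \<in> {0..1}"
    and mult: "\<And>b l. 0 < T b \<Longrightarrow> T b < 1 \<Longrightarrow> T b = T (b + int l) \<Longrightarrow> l < d"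
  shows "(bspline T i (Suc d) has_real_derivative
    real (Suc d) * (bspline T i d x / (T (i + int (Suc d)) - T i)
      - bspline T (i + 1) d x / (T (i + 1 + int (Suc d)) - T (i + 1)))) (at x within {0..1})"
proof -
  let ?W = "\<lambda>d x. weighted_jet (cut01 x) ([:- x, 1:] ^ d)"
  have deriv: "((\<lambda>x. hermite_dd (?W (Suc d) x) T a (Suc d)) has_real_derivative
      - real (Suc d) * (bspline T a d x / (T (a + int (Suc d)) - T a))) (at x within {0..1})" for a
  proof -
    have "((\<lambda>x. hermite_dd (?W (Suc d) x) T a (Suc d)) has_real_derivative
        hermite_dd (\<lambda>l y. - real (Suc d) * ?W d x l y) T a (Suc d)) (at x within {0..1})"
    proof (rule hermite_dd_has_derivative)
      fix b l
      assume "T b = T (b + int l)"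
      with mult[of b l] have "T b \<le> 0 \<or> 1 \<le> T b \<or> l < d" by linarith
      then show "((\<lambda>x. ?W (Suc d) x l (T b)) has_real_derivative - real (Suc d) * ?W d x l (T b))
        (at x within {0..1})" by (rule DERIV_cut01_jet)
    qed
    also have "hermite_dd (\<lambda>l y. - real (Suc d) * ?W d x l y) T a (Suc d) =
        - real (Suc d) * hermite_dd (?W d x) T a (Suc d)"
      using hermite_dd_sum[of "\<lambda>_. - real (Suc d)" "\<lambda>_. ?W d x" "{()}" T a "Suc d"] by simp
    also have "hermite_dd (?W d x) T a (Suc d) = bspline T a d x / (T (a + int (Suc d)) - T a)"
      using hermite_dd_linear_power_divide[OF assms(1), of "cut01 x" x d a]
        bspline_eq_hermite_dd[OF assms(1), of x a d] assms(2) by simp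
    finally show ?thesis .
  qed
  have eq: "bspline T i (Suc d) z =
      hermite_dd (?W (Suc d) z) T (i + 1) (Suc d) - hermite_dd (?W (Suc d) z) T i (Suc d)"
    if "z \<in> {0..1}" for z
    using bspline_eq_hermite_dd[OF assms(1), of z i "Suc d"] that
      hermite_dd_eq_diff[OF assms(1), of i "Suc d" "?W (Suc d) z"] by simp
  have "((\<lambda>x. hermite_dd (?W (Suc d) x) T (i + 1) (Suc d) - hermite_dd (?W (Suc d) x) T i (Suc d))
      has_real_derivative
      - real (Suc d) * (bspline T (i + 1) d x / (T (i + 1 + int (Suc d)) - T (i + 1)))
      - - real (Suc d) * (bspline T i d x / (T (i + int (Suc d)) - T i))) (at x within {0..1})"
    by (intro DERIV_diff deriv)
  then have "(bspline T i (Suc d) has_real_derivative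
      - real (Suc d) * (bspline T (i + 1) d x / (T (i + 1 + int (Suc d)) - T (i + 1)))
      - - real (Suc d) * (bspline T i d x / (T (i + int (Suc d)) - T i))) (at x within {0..1})"
    by (rule has_real_derivative_transform[OF assms(2) eq, rotated])
  then show ?thesis by (rule DERIV_cong) (simp add: right_diff_distrib del: of_nat_Suc)
qed

text \<open>A chain of functions, each the derivative of the preceding one on \<open>[0,1]\<close>, computes iterated
  derivatives; what the functions do outside \<open>[0,1]\<close> is irrelevant, since \<open>deriv01\<close> is taken within
  that interval.\<close>

lemma deriv01_funpow:
  assumes "\<And>v x. v < N \<Longrightarrow> x \<in> {0..1} \<Longrightarrow>
    (F v has_real_derivative F (Suc v) x) (at x within {0..1})"
  shows "v \<le> N \<Longrightarrow> x \<in> {0..1} \<Longrightarrow> (deriv01 ^^ v) (F 0) x = F v x"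
proof (induction v arbitrary: x)
  case (Suc v)
  define f where "f = (deriv01 ^^ v) (F 0)"
  have "(F v has_real_derivative F (Suc v) x) (at x within {0..1})"
    using assms[of v x] Suc.prems by simp
  then have "(f has_real_derivative F (Suc v) x) (at x within {0..1})"
    by (rule has_real_derivative_transform[OF Suc.prems(2), rotated]) (use Suc in \<open>auto simp: f_def\<close>)
  then have "deriv01 f x = F (Suc v) x"
    unfolding has_real_derivative_iff_has_vector_derivative deriv01_def
    using vector_derivative_within_cbox[of 0 1 x f "F (Suc v) x"] Suc.prems by simp
  then show ?case by (simp add: f_def)
qed simp

section \<open>The knot vectors\<close>

lemma knot_mono:
  assumes "knots_ok n m t" "k \<le> m"
  shows "mono (knot t k)"
proof (rule monoI)
  fix a b :: int
  assume ab: "a \<le> b"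
  have r: "0 \<le> t i" "t i \<le> 1" if "1 \<le> i" "i \<le> m" for i
    using assms(1) that by (auto simp: knots_ok_def less_imp_le)
  consider "a \<le> 0" "b \<le> 0 \<or> int k < b" | "a \<le> 0" "0 < b" "b \<le> int k"
    | "0 < a" "b \<le> int k" | "0 < a" "a \<le> int k" "int k < b" | "int k < a" "0 < a"
    by linarith
  then show "knot t k a \<le> knot t k b"
  proof cases
    case 3
    then have "nat a \<in> {1..m}" "nat b \<in> {1..m}" "nat a \<le> nat b" using ab assms(2) by auto
    then have "t (nat a) \<le> t (nat b)" using assms(1) unfolding knots_ok_def by blast
    then show ?thesis using 3 ab by (simp add: knot_def)
  qed (use ab assms(2) in \<open>auto simp: knot_def intro!: r\<close>)
qed

lemma interior_knot:
  assumes "0 < knot t k b" "knot t k b < 1"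
  shows "0 < b" "b \<le> int k" "knot t k b = t (nat b)"
  using assms by (auto simp: knot_def split: if_splits)

lemma knot_multiplicity:
  assumes "knots_ok n m t" "k \<le> m"
    and "0 < knot t k b" "knot t k b < 1" "knot t k b = knot t k (b + int l)"
  shows "l < n"
proof -
  let ?y = "knot t k b"
  note b = interior_knot[OF assms(3,4)]
  have bl: "b + int l \<le> int k" using interior_knot(2)[of t k "b + int l"] assms by simp
  have "t i = ?y" if "i \<in> {nat b..nat b + l}" for i
  proof -
    have i: "b \<le> int i" "int i \<le> b + int l" using that b(1) by auto
    then have "knot t k (int i) = t i" using b(1) bl by (simp add: knot_def)
    with mono_squeeze[OF knot_mono[OF assms(1,2)] assms(5) i] show ?thesis by metis
  qed
  then have "{nat b..nat b + l} \<subseteq> {i \<in> {1..m}. t i = ?y}"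
    using b(1) bl assms(2) by auto
  then have "card {nat b..nat b + l} \<le> card {i \<in> {1..m}. t i = ?y}" by (intro card_mono) auto
  also have "\<dots> \<le> n" using assms(1) by (auto simp: knots_ok_def)
  finally show ?thesis by simp
qed

text \<open>Interior knots keep their indices when further knots are inserted.\<close>

lemma knot_refines:
  assumes "k \<le> m" "0 < knot t k b" "knot t k b < 1" "knot t k b = knot t k (b + int l)"
  shows "\<exists>c. knot t m c = knot t k b \<and> knot t m (c + int l) = knot t k b"
proof -
  have "knot t m c = knot t k c" if "0 < knot t k c" "knot t k c < 1" for c
    using interior_knot[OF that] assms(1) by (simp add: knot_def)
  from this[of b] this[of "b + int l"] assms(2-4) show ?thesis
    by (intro exI[of _ b]) metis
qed

lemma knot_interval_exists:
  assumes "0 \<le> x" "x < 1"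
  obtains \<nu> where "0 \<le> \<nu>" "\<nu> \<le> int m" "knot t m \<nu> \<le> x" "x < knot t m (\<nu> + 1)"
proof -
  let ?P = "\<lambda>i. x < knot t m (int i)"
  have P: "?P (m + 1)" using assms(2) by (simp add: knot_def)
  define i where "i = (LEAST i. ?P i)"
  have i: "?P i" "i \<le> m + 1" unfolding i_def using P by (rule LeastI, rule Least_le)
  have "i \<noteq> 0" using i(1) assms(1) by (intro notI) (simp add: knot_def)
  then obtain j where j: "i = Suc j" by (cases i) auto
  then have "\<not> ?P j" using not_less_Least[of j ?P] i_def by simp
  then show ?thesis using i j by (intro that[of "int j"]) (auto simp: add.commute)
qed

section \<open>Differentiation down to degree n\<close>

text \<open>With \<open>c = \<lambda>\<^bsub>v,\<cdot>\<^esub>\<close>, the differences on the right are the numerators in the recursion for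
  \<open>\<lambda>\<^bsub>v+1,\<cdot>\<^esub>\<close>.\<close>

lemma sum_by_parts:
  fixes c A :: "int \<Rightarrow> real"
  assumes "c (- 1) = 0" "c (int v + 1) = 0"
  shows "(\<Sum>q=0..v. c (int q) * (A (int q) - A (int q + 1))) =
    (\<Sum>q=0..Suc v. (c (int q) - c (int q - 1)) * A (int q))"
proof -
  have "(\<Sum>q=0..v. c (int q) * (A (int q) - A (int q + 1))) =
    (\<Sum>q=0..v. (c (int q) - c (int q - 1)) * A (int q)) - c (int v) * A (int v + 1)"
    by (induction v) (use assms(1) in \<open>simp_all add: algebra_simps\<close>)
  then show ?thesis using assms(2) by (simp add: algebra_simps)
qed

lemma lam_eq_0: "q < 0 \<or> int v < q \<Longrightarrow> lam n T j v q = 0"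
  by (cases v) auto

text \<open>In the proof \<open>F v\<close> is the expansion of the \<open>v\<close>-th derivative of \<open>f\<^sub>k\<close> in B-splines of degree
  \<open>2n + 1 - v\<close>. Passing from \<open>v\<close> to \<open>v + 1\<close> requires the degree \<open>2n + 1 - v\<close>, which is at least
  \<open>n + 1\<close>, to exceed the multiplicity of each interior knot; this is what the bound \<open>n\<close> on multiplicities
  provides.\<close>

lemma LL_eq_beta_sum:
  assumes "knots_ok n m t" "1 \<le> k" "k \<le> m" "x \<in> {0..1}"
  shows "LL n t \<alpha> (n + k) x =
    (\<Sum>h=0..n + k. beta n t \<alpha> h k * bspline (knot t k) (- int n + int h) n x)"
proof -
  let ?T = "knot t k"
  let ?l = "\<lambda>j. lam n ?T j"
  have mono: "mono ?T" using knot_mono[OF assms(1,3)] .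
  define F where "F v x = (\<Sum>j=0..<k. \<alpha> (- int n + int j) k * (\<Sum>q=0..v. ?l j v (int q) *
      (fact (2 * n + 1) / fact (2 * n + 1 - v) *
        bspline ?T (- int n + int j + int q) (2 * n + 1 - v) x)))" for v x
  have F: "(F v has_real_derivative F (Suc v) x) (at x within {0..1})"
    if v: "v < n + 1" and x: "x \<in> {0..1}" for v x
  proof -
    define d where "d = 2 * n - v"
    have d: "2 * n + 1 - v = Suc d" "2 * n + 1 - Suc v = d" "n \<le> d" "int d = 2 * int n - int v"
      using v by (auto simp: d_def)
    let ?c = "fact (2 * n + 1) / fact d :: real"
    have c: "fact (2 * n + 1) / fact (Suc d) * real (Suc d) = ?c"
      unfolding fact_Suc[of d] by (simp del: of_nat_Suc fact_Suc)
    define A where "A j q = bspline ?T (- int n + int j + q) d x /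
        (?T (- int n + int j + q + int (Suc d)) - ?T (- int n + int j + q))" for j :: nat and q :: int
    have B: "((\<lambda>x. fact (2 * n + 1) / fact (Suc d) * bspline ?T (- int n + int j + int q) (Suc d) x)
        has_real_derivative ?c * (A j (int q) - A j (int q + 1))) (at x within {0..1})" for j q
    proof -
      have "(bspline ?T (- int n + int j + int q) (Suc d) has_real_derivative
          real (Suc d) * (A j (int q) - A j (int q + 1))) (at x within {0..1})"
        unfolding A_def add.assoc[symmetric]
        by (rule bspline_has_derivative[OF mono x])
           (use knot_multiplicity[OF assms(1,3)] d(3) in \<open>blast intro: less_le_trans\<close>)
      from DERIV_cmult[OF this, of "fact (2 * n + 1) / fact (Suc d)"] show ?thesis
        unfolding c[symmetric] by (simp only: mult.assoc)
    qed
    \<comment> \<open>One step of the recursion for \<open>\<lambda>\<close>: its denominator is the length of the support that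
      normalises the B-spline in \<open>A\<close>.\<close>
    have S: "(\<Sum>q=0..v. ?l j v (int q) * (?c * (A j (int q) - A j (int q + 1)))) =
        (\<Sum>q=0..Suc v. ?l j (Suc v) (int q) * (?c * bspline ?T (- int n + int j + int q) d x))" for j
    proof -
      have "(\<Sum>q=0..v. ?l j v (int q) * (?c * (A j (int q) - A j (int q + 1)))) =
          ?c * (\<Sum>q=0..v. ?l j v (int q) * (A j (int q) - A j (int q + 1)))"
        by (simp only: sum_distrib_left mult_ac)
      also have "\<dots> = ?c * (\<Sum>q=0..Suc v. (?l j v (int q) - ?l j v (int q - 1)) * A j (int q))"
        by (subst sum_by_parts) (simp_all add: lam_eq_0)
      also have "\<dots> = (\<Sum>q=0..Suc v. ?c * ((?l j v (int q) - ?l j v (int q - 1)) * A j (int q)))"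
        by (rule sum_distrib_left)
      also have "\<dots> = (\<Sum>q=0..Suc v. ?l j (Suc v) (int q) *
          (?c * bspline ?T (- int n + int j + int q) d x))"
      proof (rule sum.cong[OF refl])
        fix q assume "q \<in> {0..Suc v}"
        moreover have idx: "int n + int j + int q - int (Suc v) + 2 = - int n + int j + int q + int (Suc d)"
          using d(4) by simp
        ultimately have "?l j (Suc v) (int q) = (?l j v (int q) - ?l j v (int q - 1)) /
            (?T (- int n + int j + int q + int (Suc d)) - ?T (- int n + int j + int q))"
          unfolding lam.simps idx by (simp del: of_nat_Suc)
        then show "?c * ((?l j v (int q) - ?l j v (int q - 1)) * A j (int q)) =
          ?l j (Suc v) (int q) * (?c * bspline ?T (- int n + int j + int q) d x)"
          by (simp add: A_def mult_ac del: of_nat_Suc fact_Suc lam.simps)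
      qed
      finally show ?thesis .
    qed
    have "(F v has_real_derivative (\<Sum>j=0..<k. \<alpha> (- int n + int j) k *
        (\<Sum>q=0..v. ?l j v (int q) * (?c * (A j (int q) - A j (int q + 1)))))) (at x within {0..1})"
      unfolding F_def d(1) by (intro DERIV_sum DERIV_cmult B)
    then show ?thesis unfolding S by (simp only: F_def d(2))
  qed
  have "LL n t \<alpha> (n + k) x = (deriv01 ^^ (n + 1)) (F 0) x"
  proof -
    have "fk n t \<alpha> k = F 0" by (rule ext) (simp add: fk_def F_def)
    then show ?thesis using assms(2) by (simp add: LL_def)
  qed
  also have "\<dots> = F (n + 1) x"
    using deriv01_funpow[of "n + 1" F "n + 1" x] F assms(4) by blast
  \<comment> \<open>With \<open>h = j + q\<close>; since \<open>\<lambda>\<close> vanishes outside its triangle, \<open>h\<close> may run over the whole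
    range for every \<open>j\<close>, and the order of summation can be changed.\<close>
  also have "\<dots> = (\<Sum>j=0..<k. \<Sum>h=0..n + k. \<alpha> (- int n + int j) k * (?l j (n + 1) (int h - int j) *
      (fact (2 * n + 1) / fact n * bspline ?T (- int n + int h) n x)))"
    unfolding F_def sum_distrib_left
  proof (rule sum.cong[OF refl])
    fix j assume j: "j \<in> {0..<k}"
    let ?g = "\<lambda>h. \<alpha> (- int n + int j) k * (?l j (n + 1) (int h - int j) *
      (fact (2 * n + 1) / fact n * bspline ?T (- int n + int h) n x))"
    have "(\<Sum>h=0..n + k. ?g h) = (\<Sum>h=j..n + 1 + j. ?g h)"
    proof (rule sum.mono_neutral_right)
      show "\<forall>h\<in>{0..n + k} - {j..n + 1 + j}. ?g h = 0"
      proof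
        fix h assume "h \<in> {0..n + k} - {j..n + 1 + j}"
        then have "?l j (n + 1) (int h - int j) = 0" by (intro lam_eq_0) auto
        then show "?g h = 0" by simp
      qed
    qed (use j in auto)
    also have "\<dots> = (\<Sum>q=0..n + 1. ?g (q + j))"
      using sum.shift_bounds_cl_nat_ivl[of ?g 0 j "n + 1"] by simp
    finally show "(\<Sum>q=0..n + 1. \<alpha> (- int n + int j) k * (?l j (n + 1) (int q) *
        (fact (2 * n + 1) / fact (2 * n + 1 - (n + 1)) *
          bspline ?T (- int n + int j + int q) (2 * n + 1 - (n + 1)) x))) = (\<Sum>h=0..n + k. ?g h)"
      by (simp add: add_ac del: lam.simps fact_Suc)
  qed
  also have "\<dots> = (\<Sum>h=0..n + k. beta n t \<alpha> h k * bspline ?T (- int n + int h) n x)"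
    unfolding beta_def sum_distrib_left sum_distrib_right
    by (subst sum.swap) (simp only: mult_ac)
  finally show ?thesis .
qed

section \<open>Expansion over the finest knots\<close>

lemma gfun_eq_cut_dual_poly:
  "gfun n m t s i = (\<lambda>y. of_bool (s i < y) * poly (dual_poly (knot t m) n (- int n + int i)) y)"
  by (rule ext) (simp add: gfun_def dual_poly_def poly_prod)

text \<open>For \<open>x < 1\<close> this is knot insertion for the recursion; both sides are continuous from the left
  at \<open>x = 1\<close>.\<close>

lemma bspline_knot_insertion:
  assumes ok: "knots_ok n m t" and k: "k \<le> m"
    and s: "\<And>i. i \<le> n + m \<Longrightarrow> s i \<in> {knot t m (- int n + int i)..<knot t m (int i + 1)}"
    and x: "x \<in> {0..1}"
  shows "bspline (knot t k) a n x =
    (\<Sum>i=0..n + m. (knot t k (a + int (n + 1)) - knot t k a) *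
        divdiff (gfun n m t s i) (knot t k) a (n + 1) * bspline (knot t m) (- int n + int i) n x)"
proof -
  define c where "c i = (knot t k (a + int (n + 1)) - knot t k a) *
    divdiff (gfun n m t s i) (knot t k) a (n + 1)" for i
  have mono: "mono (knot t m)" "mono (knot t k)" using knot_mono[OF ok] k by auto
  have rec: "bspline_rec (knot t k) a n x =
      (\<Sum>i=0..n + m. c i * bspline_rec (knot t m) (- int n + int i) n x)"
    if x: "0 \<le> x" "x < 1" for x
  proof -
    obtain \<nu> where \<nu>: "0 \<le> \<nu>" "\<nu> \<le> int m" "knot t m \<nu> \<le> x" "x < knot t m (\<nu> + 1)"
      using knot_interval_exists[OF x, of m t] by blast
    let ?f = "\<lambda>i. (knot t k (a + int (Suc n)) - knot t k a) *
        hermite_dd (weighted_jet (\<lambda>y. of_bool (s (nat (i + int n)) < y)) (dual_poly (knot t m) n i))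
          (knot t k) a (Suc n) * bspline_rec (knot t m) i n x"
    have "bspline_rec (knot t k) a n x = (\<Sum>i=- int n..int m. ?f i)"
    proof (rule bspline_rec_knot_insertion[OF mono \<nu>(3,4)])
      show "\<exists>c. knot t m c = knot t k b \<and> knot t m (c + int l) = knot t k b"
        if "knot t m (- int n) < knot t k b" "knot t k b < knot t m (int m + int (Suc n))"
          "knot t k b = knot t k (b + int l)" for b l
        using that by (intro knot_refines[OF k]) (simp_all add: knot_def)
      show "knot t m i \<le> s (nat (i + int n)) \<and> s (nat (i + int n)) < knot t m (i + int (Suc n))"
        if "- int n \<le> i" "i \<le> int m" for i
        using s[of "nat (i + int n)"] that by (simp add: add_ac)
    qed (use \<nu> in auto)
    also have "\<dots> = (\<Sum>i=0..n + m. ?f (- int n + int i))"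
      by (rule sum.reindex_bij_witness[of _ "\<lambda>i. - int n + int i" "\<lambda>i. nat (i + int n)"]) auto
    also have "\<dots> = (\<Sum>i=0..n + m. c i * bspline_rec (knot t m) (- int n + int i) n x)"
      unfolding c_def gfun_eq_cut_dual_poly divdiff_cut_poly by simp
    finally show ?thesis .
  qed
  have "bspline (knot t k) a n x = (\<Sum>i=0..n + m. c i * bspline (knot t m) (- int n + int i) n x)"
  proof (cases "x = 1")
    case False
    then show ?thesis using rec[of x] x by (simp add: bspline_def)
  next
    case True
    have "\<forall>\<^sub>F x in at_left 1. (\<Sum>i=0..n + m. c i * bspline_rec (knot t m) (- int n + int i) n x) =
        bspline_rec (knot t k) a n x"
      by (rule eventually_at_leftI[of 0]) (simp_all add: rec)
    moreover have "((\<lambda>x. \<Sum>i=0..n + m. c i * bspline_rec (knot t m) (- int n + int i) n x)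
        \<longlongrightarrow> (\<Sum>i=0..n + m. c i * bspline (knot t m) (- int n + int i) n 1)) (at_left 1)"
      by (intro tendsto_sum tendsto_mult tendsto_const bspline_rec_tendsto_bspline mono)
    ultimately have "(bspline_rec (knot t k) a n
        \<longlongrightarrow> (\<Sum>i=0..n + m. c i * bspline (knot t m) (- int n + int i) n 1)) (at_left 1)"
      by (rule Lim_transform_eventually[rotated])
    from tendsto_unique[OF trivial_limit_at_left_real bspline_rec_tendsto_bspline[OF mono(2)] this]
    show ?thesis using True by simp
  qed
  then show ?thesis unfolding c_def .
qed

theorem lemma3p2:
  fixes n m :: nat
    and t :: "nat \<Rightarrow> real"
    and \<alpha> :: "int \<Rightarrow> nat \<Rightarrow> real"
    and s :: "nat \<Rightarrow> real"
  assumes "n \<ge> 1" and "m \<ge> 1"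
    and "knots_ok n m t"
    and "orthogonal_basis (spline_space n t m) (n + m) (LL n t \<alpha>)"
    and "\<And>i. i \<le> n + m \<Longrightarrow> s i \<in> {knot t m (- int n + int i)..<knot t m (int i + 1)}"
  shows "(\<forall>k x. 1 \<le> k \<and> k < m \<and> x \<in> {0..1} \<longrightarrow>
            LL n t \<alpha> (n + k) x =
              (\<Sum>i=0..n + m. gam n m t \<alpha> s i k * bspline (knot t m) (- int n + int i) n x))
       \<and> (\<forall>x\<in>{0..1}.
            LL n t \<alpha> (n + m) x =
              (\<Sum>i=0..n + m. beta n t \<alpha> i m * bspline (knot t m) (- int n + int i) n x))"
proof (intro conjI allI impI ballI)
  fix k and x :: real
  assume kx: "1 \<le> k \<and> k < m \<and> x \<in> {0..1}"
  then have k: "k \<le> m" and x: "x \<in> {0..1}" by auto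
  define c where "c i h = (knot t k (int h + 1) - knot t k (- int n + int h)) *
    divdiff (gfun n m t s i) (knot t k) (- int n + int h) (n + 1)" for i h
  have "LL n t \<alpha> (n + k) x =
      (\<Sum>h=0..n + k. beta n t \<alpha> h k * bspline (knot t k) (- int n + int h) n x)"
    by (rule LL_eq_beta_sum[OF assms(3)]) (use kx in auto)
  also have "\<dots> = (\<Sum>h=0..n + k. beta n t \<alpha> h k *
      (\<Sum>i=0..n + m. c i h * bspline (knot t m) (- int n + int i) n x))"
  proof (rule sum.cong[OF refl])
    fix h
    have idx: "- int n + int h + int (n + 1) = int h + 1" by simp
    have "bspline (knot t k) (- int n + int h) n x =
        (\<Sum>i=0..n + m. c i h * bspline (knot t m) (- int n + int i) n x)"
      using bspline_knot_insertion[OF assms(3) k assms(5) x, of "- int n + int h"]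
      unfolding idx c_def .
    then show "beta n t \<alpha> h k * bspline (knot t k) (- int n + int h) n x = beta n t \<alpha> h k *
      (\<Sum>i=0..n + m. c i h * bspline (knot t m) (- int n + int i) n x)" by (rule arg_cong)
  qed
  also have "\<dots> = (\<Sum>h=0..n + k. \<Sum>i=0..n + m.
      beta n t \<alpha> h k * c i h * bspline (knot t m) (- int n + int i) n x)"
    by (simp only: sum_distrib_left mult.assoc)
  also have "\<dots> = (\<Sum>i=0..n + m. \<Sum>h=0..n + k.
      beta n t \<alpha> h k * c i h * bspline (knot t m) (- int n + int i) n x)"
    by (rule sum.swap)
  also have "\<dots> = (\<Sum>i=0..n + m. gam n m t \<alpha> s i k * bspline (knot t m) (- int n + int i) n x)"
    by (simp only: gam_def c_def sum_distrib_right mult.assoc)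
  finally show "LL n t \<alpha> (n + k) x =
    (\<Sum>i=0..n + m. gam n m t \<alpha> s i k * bspline (knot t m) (- int n + int i) n x)" .
next
  fix x :: real
  assume "x \<in> {0..1}"
  then show "LL n t \<alpha> (n + m) x =
    (\<Sum>i=0..n + m. beta n t \<alpha> i m * bspline (knot t m) (- int n + int i) n x)"
    by (intro LL_eq_beta_sum[OF assms(3)]) (use assms(2) in auto)
qed

end
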